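(* Let $\mathbf{V}$ be a cartesian category and let $\mathbf{C}$ be a strict cartesian effect category extending $\mathbf{V}$. Define: - for all points $X,Y$, the set $A(X,Y)=\mathbf{C}(X,Y)$ of all functions from $X$ to $Y$ in $\mathbf{C}$; - $\mathtt{arr}:\mathbf{V}(X,Y)\to A(X,Y)$, the inclusion $\mathbf{V}(X,Y)\subseteq \mathbf{C}(X,Y)$; - $(>\!\!>\!\!>): A(X,Y)\to A(Y,Z)\to A(X,Z)$, $f >\!\!>\!\!> g = g\circ f$; - $\mathtt{first}: A(X,Y)\to A(X\times Z,Y\times Z)$, $\mathtt{first}\, f = f\times \mathrm{id}_Z$ (the semi-product of $f$ with the pure function $\mathrm{id}_Z$). Then $A$, with these operations, is an Arrow on $\mathbf{V}$.
   Context: A weak category is a directed multigraph (vertices are called points, edges are called functions) with an identity $\mathrm{id}_X:X\to X$ for each point $X$, a composition $g\circ f:X\to Z$ for all $f:X\to Y$, $g:Y\to Z$, and a relation $\equiv$ between parallel functions which is a congruence (an equivalence relation such that $g_1\equiv g_2$ implies $g_1\circ f\equiv g_2\circ f$ and $h\circ g_1\equiv h\circ g_2$ whenever defined), such that $f\circ\mathrm{id}_X\equiv f$, $\mathrm{id}_Y\circ f\equiv f$ and $h\circ(g\circ f)\equiv(h\circ g)\circ f$. A cartesian weak category is a weak category with a chosen terminal point $U$ (for every point $X$ there is a function $\langle\,\rangle_X:X\to U$, unique up to $\equiv$) and, for all points $Y_1,Y_2$, a chosen binary product with projections $q_i:Y_1\times Y_2\to Y_i$ (for all $f_1:X\to Y_1$,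 $f_2:X\to Y_2$ there is $\langle f_1,f_2\rangle:X\to Y_1\times Y_2$, unique up to $\equiv$, with $q_i\circ\langle f_1,f_2\rangle\equiv f_i$ for $i=1,2$). An effect category extending a weak category $\mathbf{V}$ is a weak category $\mathbf{C}$ such that $\mathbf{V}$ is a wide subcategory of $\mathbf{C}$ (same points; the functions of $\mathbf{V}$ are functions of $\mathbf{C}$, with the identities and compositions of $\mathbf{C}$; parallel functions of $\mathbf{V}$ are congruent in $\mathbf{V}$ iff they are congruent in $\mathbf{C}$), together with a relation $\lesssim$ between parallel functions of $\mathbf{C}$ such that: (i) $f_1\equiv f_2$ implies $f_1\lesssim f_2$; (ii) $\lesssim$ is transitive; (iii) for $v_1,v_2$ in $\mathbf{V}$, $v_1\equiv v_2$ iff $v_1\lesssim v_2$; (iv) if $f:X\to Y$ and $g_1\lesssim g_2:Y\to Z$ then $g_1\circ f\lesssim g_2\circ f$; (v) if $g_1\lesssim g_2:Y\to Z$ and $v:Z\to W$ is in $\mathbf{V}$ then $v\circ g_1\lesssim v\circ g_2$. Functions in $\mathbf{V}$ are called pure. A cartesian effect category extending a cartesian weak category $\mathbf{V}$ is an effect category $\mathbf{C}$ extending $\mathbf{V}$ such that: each terminal point $U$ of $\mathbf{V}$ satisfies $g\lesssim\langle\,\rangle_X$ for every $g:X\to U$ in $\mathbf{C}$; and each binary product $(Y_1\times Y_2,q_1,q_2)$ of $\mathbf{V}$ is a semi-product in $\mathbf{C}$, i.e. for every $f_1:X\to Y_1$ in $\mathbf{C}$ and pure $v_2:X\to Y_2$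 there is $\langle f_1,v_2\rangle:X\to Y_1\times Y_2$ in $\mathbf{C}$, unique up to $\equiv$, with $q_1\circ\langle f_1,v_2\rangle\equiv f_1$ and $q_2\circ\langle f_1,v_2\rangle\lesssim v_2$, and for every pure $v_1:X\to Y_1$ and $f_2:X\to Y_2$ in $\mathbf{C}$ there is $\langle v_1,f_2\rangle:X\to Y_1\times Y_2$ in $\mathbf{C}$, unique up to $\equiv$, with $q_1\circ\langle v_1,f_2\rangle\lesssim v_1$ and $q_2\circ\langle v_1,f_2\rangle\equiv f_2$. When both components are pure, these pairs agree up to $\equiv$ with the pair in $\mathbf{V}$, and $\langle v_1,v_2\rangle$ denotes the (pure) pair in $\mathbf{V}$. It is strict when $\equiv$ is equality (so $\mathbf{V}$ is then an ordinary category with a chosen terminal object and chosen binary products, i.e. a cartesian category, and $\mathbf{C}$ is an ordinary category). For $f_1:X_1\to Y_1$ in $\mathbf{C}$ and $v_2:X_2\to Y_2$ pure, with projections $p_i:X_1\times X_2\to X_i$, the semi-product is $f_1\times v_2=\langle f_1\circ p_1,v_2\circ p_2\rangle:X_1\times X_2\to Y_1\times Y_2$. An Arrow $A$ on a cartesian category $\mathbf{V}$ associates to all points $X,Y$ of $\mathbf{V}$ a set $A(X,Y)$, together with operations $\mathtt{arr}:\mathbf{V}(X,Y)\to A(X,Y)$, $(>\!\!>\!\!>):A(X,Y)\to A(Y,Z)\to A(X,Z)$ and $\mathtt{first}:A(X,Y)\to A(X\times Z,Y\times Z)$ (for all $X,Y,Z$) satisfying, for all $f,g,h$ in the sets $A(-,-)$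 and $v,w$ in $\mathbf{V}$ of suitable types: (1) $\mathtt{arr}\,\mathrm{id}>\!\!>\!\!>f=f$; (2) $f>\!\!>\!\!>\mathtt{arr}\,\mathrm{id}=f$; (3) $(f>\!\!>\!\!>g)>\!\!>\!\!>h=f>\!\!>\!\!>(g>\!\!>\!\!>h)$; (4) $\mathtt{arr}(w\circ v)=\mathtt{arr}\,v>\!\!>\!\!>\mathtt{arr}\,w$; (5) $\mathtt{first}(\mathtt{arr}\,v)=\mathtt{arr}(v\times\mathrm{id})$; (6) $\mathtt{first}(f>\!\!>\!\!>g)=\mathtt{first}\,f>\!\!>\!\!>\mathtt{first}\,g$; (7) $\mathtt{first}\,f>\!\!>\!\!>\mathtt{arr}(\mathrm{id}\times v)=\mathtt{arr}(\mathrm{id}\times v)>\!\!>\!\!>\mathtt{first}\,f$; (8) $\mathtt{first}\,f>\!\!>\!\!>\mathtt{arr}\,\mathtt{fst}=\mathtt{arr}\,\mathtt{fst}>\!\!>\!\!>f$; (9) $\mathtt{first}(\mathtt{first}\,f)>\!\!>\!\!>\mathtt{arr}\,\mathtt{assoc}=\mathtt{arr}\,\mathtt{assoc}>\!\!>\!\!>\mathtt{first}\,f$. Here $\times$ in (5),(7) is the product of functions in $\mathbf{V}$, $\mathtt{fst}:X\times Y\to X$ is the first projection, and $\mathtt{assoc}:(X\times Y)\times Z\to X\times(Y\times Z)$ is the canonical associativity isomorphism of $\mathbf{V}$. *)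

theory Defs
  imports Main
begin

section \<open>Weak categories\<close>

record ('o, 'f) weak_cat =
  Pts :: "'o set"
  Funs :: "'f set"
  src :: "'f \<Rightarrow> 'o"
  tgt :: "'f \<Rightarrow> 'o"
  ident :: "'o \<Rightarrow> 'f"
  cmp :: "'f \<Rightarrow> 'f \<Rightarrow> 'f"  (infixr \<open>\<odot>\<index>\<close> 70)  \<comment> \<open>\<open>g \<odot> f\<close> is \<open>g\<close> after \<open>f\<close>\<close>
  cong :: "'f \<Rightarrow> 'f \<Rightarrow> bool"  (infix \<open>\<cong>\<index>\<close> 50)

definition Hom :: "('o, 'f, 'm) weak_cat_scheme \<Rightarrow> 'o \<Rightarrow> 'o \<Rightarrow> 'f set" where
  "Hom C X Y = {f \<in> Funs C. src C f = X \<and> tgt C f = Y}"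

definition parallel :: "('o, 'f, 'm) weak_cat_scheme \<Rightarrow> 'f \<Rightarrow> 'f \<Rightarrow> bool" where
  "parallel C f g \<longleftrightarrow> f \<in> Funs C \<and> g \<in> Funs C \<and> src C f = src C g \<and> tgt C f = tgt C g"

locale weak_category =
  fixes C :: "('o, 'f, 'm) weak_cat_scheme" (structure)
  assumes src_closed: "f \<in> Funs C \<Longrightarrow> src C f \<in> Pts C"
    and tgt_closed: "f \<in> Funs C \<Longrightarrow> tgt C f \<in> Pts C"
    and ident_closed: "X \<in> Pts C \<Longrightarrow> ident C X \<in> Hom C X X"
    and cmp_closed: "f \<in> Hom C X Y \<Longrightarrow> g \<in> Hom C Y Z \<Longrightarrow> g \<odot> f \<in> Hom C X Z"
    and cong_parallel: "f \<cong> g \<Longrightarrow> parallel C f g"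
    and cong_refl: "f \<in> Funs C \<Longrightarrow> f \<cong> f"
    and cong_sym: "f \<cong> g \<Longrightarrow> g \<cong> f"
    and cong_trans: "f \<cong> g \<Longrightarrow> g \<cong> h \<Longrightarrow> f \<cong> h"
    and cong_precomp:
      "f \<in> Hom C X Y \<Longrightarrow> g\<^sub>1 \<in> Hom C Y Z \<Longrightarrow> g\<^sub>1 \<cong> g\<^sub>2 \<Longrightarrow> g\<^sub>1 \<odot> f \<cong> g\<^sub>2 \<odot> f"
    and cong_postcomp:
      "g\<^sub>1 \<in> Hom C Y Z \<Longrightarrow> h \<in> Hom C Z W \<Longrightarrow> g\<^sub>1 \<cong> g\<^sub>2 \<Longrightarrow> h \<odot> g\<^sub>1 \<cong> h \<odot> g\<^sub>2"
    and ident_right: "f \<in> Hom C X Y \<Longrightarrow> f \<odot> ident C X \<cong> f"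
    and ident_left: "f \<in> Hom C X Y \<Longrightarrow> ident C Y \<odot> f \<cong> f"
    and cmp_assoc:
      "f \<in> Hom C X Y \<Longrightarrow> g \<in> Hom C Y Z \<Longrightarrow> h \<in> Hom C Z W \<Longrightarrow>
        h \<odot> (g \<odot> f) \<cong> (h \<odot> g) \<odot> f"

definition strict :: "('o, 'f, 'm) weak_cat_scheme \<Rightarrow> bool" where
  "strict C \<longleftrightarrow> (\<forall>f\<in>Funs C. \<forall>g\<in>Funs C. cong C f g \<longleftrightarrow> f = g)"

text \<open>Existence of a function \<open>X \<rightarrow> Y\<close> satisfying \<open>Q\<close>, unique up to congruence.\<close>

definition ex1_cong ::
    "('o, 'f, 'm) weak_cat_scheme \<Rightarrow> 'o \<Rightarrow> 'o \<Rightarrow> ('f \<Rightarrow> bool) \<Rightarrow> bool" where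
  "ex1_cong C X Y Q \<longleftrightarrow> (\<exists>h\<in>Hom C X Y. Q h \<and> (\<forall>h'\<in>Hom C X Y. Q h' \<longrightarrow> cong C h' h))"

section \<open>Cartesian weak categories\<close>

definition terminal_point :: "('o, 'f, 'm) weak_cat_scheme \<Rightarrow> 'o \<Rightarrow> bool" where
  "terminal_point V U \<longleftrightarrow> U \<in> Pts V \<and> (\<forall>X\<in>Pts V. ex1_cong V X U (\<lambda>_. True))"

definition binary_product ::
    "('o, 'f, 'm) weak_cat_scheme \<Rightarrow> 'o \<Rightarrow> 'o \<Rightarrow> 'o \<Rightarrow> 'f \<Rightarrow> 'f \<Rightarrow> bool" where
  "binary_product V Y\<^sub>1 Y\<^sub>2 P q\<^sub>1 q\<^sub>2 \<longleftrightarrow>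
    q\<^sub>1 \<in> Hom V P Y\<^sub>1 \<and> q\<^sub>2 \<in> Hom V P Y\<^sub>2 \<and>
    (\<forall>X\<in>Pts V. \<forall>f\<^sub>1\<in>Hom V X Y\<^sub>1. \<forall>f\<^sub>2\<in>Hom V X Y\<^sub>2.
      ex1_cong V X P (\<lambda>h. q\<^sub>1 \<odot>\<^bsub>V\<^esub> h \<cong>\<^bsub>V\<^esub> f\<^sub>1 \<and> q\<^sub>2 \<odot>\<^bsub>V\<^esub> h \<cong>\<^bsub>V\<^esub> f\<^sub>2))"

record ('o, 'f) cart_weak_cat = "('o, 'f) weak_cat" +
  termpt :: "'o"
  prodpt :: "'o \<Rightarrow> 'o \<Rightarrow> 'o"
  prj1 :: "'o \<Rightarrow> 'o \<Rightarrow> 'f"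
  prj2 :: "'o \<Rightarrow> 'o \<Rightarrow> 'f"

locale cartesian_weak_category = weak_category V
  for V :: "('o, 'f, 'm) cart_weak_cat_scheme" (structure) +
  assumes terminal: "terminal_point V (termpt V)"
    and product: "Y\<^sub>1 \<in> Pts V \<Longrightarrow> Y\<^sub>2 \<in> Pts V \<Longrightarrow>
      binary_product V Y\<^sub>1 Y\<^sub>2 (prodpt V Y\<^sub>1 Y\<^sub>2) (prj1 V Y\<^sub>1 Y\<^sub>2) (prj2 V Y\<^sub>1 Y\<^sub>2)"

locale cartesian_category = cartesian_weak_category V
  for V :: "('o, 'f, 'm) cart_weak_cat_scheme" (structure) +
  assumes strict: "strict V"

text \<open>The pair of \<open>f\<^sub>1 : X \<rightarrow> Y\<^sub>1\<close> and \<open>f\<^sub>2 : X \<rightarrow> Y\<^sub>2\<close>, which is determined only up to congruence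
  in a cartesian weak category, and is unique in a cartesian category.\<close>

definition pair :: "('o, 'f, 'm) cart_weak_cat_scheme \<Rightarrow> 'f \<Rightarrow> 'f \<Rightarrow> 'f" where
  "pair V f\<^sub>1 f\<^sub>2 = (SOME h.
    h \<in> Hom V (src V f\<^sub>1) (prodpt V (tgt V f\<^sub>1) (tgt V f\<^sub>2)) \<and>
    prj1 V (tgt V f\<^sub>1) (tgt V f\<^sub>2) \<odot>\<^bsub>V\<^esub> h \<cong>\<^bsub>V\<^esub> f\<^sub>1 \<and>
    prj2 V (tgt V f\<^sub>1) (tgt V f\<^sub>2) \<odot>\<^bsub>V\<^esub> h \<cong>\<^bsub>V\<^esub> f\<^sub>2)"

definition prodfun :: "('o, 'f, 'm) cart_weak_cat_scheme \<Rightarrow> 'f \<Rightarrow> 'f \<Rightarrow> 'f" where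
  "prodfun V f\<^sub>1 f\<^sub>2 = pair V
    (f\<^sub>1 \<odot>\<^bsub>V\<^esub> prj1 V (src V f\<^sub>1) (src V f\<^sub>2))
    (f\<^sub>2 \<odot>\<^bsub>V\<^esub> prj2 V (src V f\<^sub>1) (src V f\<^sub>2))"

text \<open>\<open>assoc V X Y Z : (X \<times> Y) \<times> Z \<rightarrow> X \<times> (Y \<times> Z)\<close>\<close>

definition assoc :: "('o, 'f, 'm) cart_weak_cat_scheme \<Rightarrow> 'o \<Rightarrow> 'o \<Rightarrow> 'o \<Rightarrow> 'f" where
  "assoc V X Y Z = pair V
    (prj1 V X Y \<odot>\<^bsub>V\<^esub> prj1 V (prodpt V X Y) Z)
    (pair V (prj2 V X Y \<odot>\<^bsub>V\<^esub> prj1 V (prodpt V X Y) Z) (prj2 V (prodpt V X Y) Z))"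

section \<open>Cartesian effect categories\<close>

record ('o, 'f) effect_cat = "('o, 'f) weak_cat" +
  lesssim :: "'f \<Rightarrow> 'f \<Rightarrow> bool"  (infix \<open>\<lesssim>\<index>\<close> 50)

definition wide_subcategory ::
    "('o, 'f, 'm) weak_cat_scheme \<Rightarrow> ('o, 'f, 'n) weak_cat_scheme \<Rightarrow> bool" where
  "wide_subcategory V C \<longleftrightarrow>
    Pts V = Pts C \<and> Funs V \<subseteq> Funs C \<and>
    (\<forall>v\<in>Funs V. src V v = src C v \<and> tgt V v = tgt C v) \<and>
    (\<forall>X\<in>Pts V. ident V X = ident C X) \<and>
    (\<forall>v\<in>Funs V. \<forall>w\<in>Funs V. tgt V v = src V w \<longrightarrow> w \<odot>\<^bsub>V\<^esub> v = w \<odot>\<^bsub>C\<^esub> v) \<and>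
    (\<forall>v w. parallel V v w \<longrightarrow> (v \<cong>\<^bsub>V\<^esub> w \<longleftrightarrow> v \<cong>\<^bsub>C\<^esub> w))"

locale effect_category = V: weak_category V + C: weak_category C
  for V :: "('o, 'f, 'm) weak_cat_scheme" and C :: "('o, 'f, 'n) effect_cat_scheme" +
  assumes wide: "wide_subcategory V C"
    and lesssim_parallel: "f \<lesssim>\<^bsub>C\<^esub> g \<Longrightarrow> parallel C f g"
    and cong_lesssim: "f \<cong>\<^bsub>C\<^esub> g \<Longrightarrow> f \<lesssim>\<^bsub>C\<^esub> g"
    and lesssim_trans: "f \<lesssim>\<^bsub>C\<^esub> g \<Longrightarrow> g \<lesssim>\<^bsub>C\<^esub> h \<Longrightarrow> f \<lesssim>\<^bsub>C\<^esub> h"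
    and lesssim_pure: "v\<^sub>1 \<in> Funs V \<Longrightarrow> v\<^sub>2 \<in> Funs V \<Longrightarrow> v\<^sub>1 \<cong>\<^bsub>C\<^esub> v\<^sub>2 \<longleftrightarrow> v\<^sub>1 \<lesssim>\<^bsub>C\<^esub> v\<^sub>2"
    and lesssim_precomp:
      "f \<in> Hom C X Y \<Longrightarrow> g\<^sub>1 \<in> Hom C Y Z \<Longrightarrow> g\<^sub>1 \<lesssim>\<^bsub>C\<^esub> g\<^sub>2 \<Longrightarrow>
        g\<^sub>1 \<odot>\<^bsub>C\<^esub> f \<lesssim>\<^bsub>C\<^esub> g\<^sub>2 \<odot>\<^bsub>C\<^esub> f"
    and lesssim_postcomp:
      "g\<^sub>1 \<in> Hom C Y Z \<Longrightarrow> v \<in> Hom V Z W \<Longrightarrow> g\<^sub>1 \<lesssim>\<^bsub>C\<^esub> g\<^sub>2 \<Longrightarrow>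
        v \<odot>\<^bsub>C\<^esub> g\<^sub>1 \<lesssim>\<^bsub>C\<^esub> v \<odot>\<^bsub>C\<^esub> g\<^sub>2"

definition is_semi_product ::
    "('o, 'f, 'm) weak_cat_scheme \<Rightarrow> ('o, 'f, 'n) effect_cat_scheme \<Rightarrow>
      'o \<Rightarrow> 'o \<Rightarrow> 'o \<Rightarrow> 'f \<Rightarrow> 'f \<Rightarrow> bool" where
  "is_semi_product V C Y\<^sub>1 Y\<^sub>2 P q\<^sub>1 q\<^sub>2 \<longleftrightarrow>
    (\<forall>X\<in>Pts C. \<forall>f\<^sub>1\<in>Hom C X Y\<^sub>1. \<forall>v\<^sub>2\<in>Hom V X Y\<^sub>2.
      ex1_cong C X P (\<lambda>h. q\<^sub>1 \<odot>\<^bsub>C\<^esub> h \<cong>\<^bsub>C\<^esub> f\<^sub>1 \<and> q\<^sub>2 \<odot>\<^bsub>C\<^esub> h \<lesssim>\<^bsub>C\<^esub> v\<^sub>2)) \<and>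
    (\<forall>X\<in>Pts C. \<forall>v\<^sub>1\<in>Hom V X Y\<^sub>1. \<forall>f\<^sub>2\<in>Hom C X Y\<^sub>2.
      ex1_cong C X P (\<lambda>h. q\<^sub>1 \<odot>\<^bsub>C\<^esub> h \<lesssim>\<^bsub>C\<^esub> v\<^sub>1 \<and> q\<^sub>2 \<odot>\<^bsub>C\<^esub> h \<cong>\<^bsub>C\<^esub> f\<^sub>2))"

text \<open>The two conditions below range over all terminal points and all binary products of \<open>V\<close>, not
  only the chosen ones; since terminal points and products are unique up to a pure isomorphism
  compatible with \<open>\<lesssim>\<close>, this amounts to requiring them for the chosen ones. The function
  \<open>X \<rightarrow> U\<close> of \<open>V\<close> is unique up to congruence, so \<open>t\<close> below is \<open>\<langle> \<rangle>\<^sub>X\<close>.\<close>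

locale cartesian_effect_category = V: cartesian_weak_category V + effect_category V C
  for V :: "('o, 'f, 'm) cart_weak_cat_scheme" and C :: "('o, 'f, 'n) effect_cat_scheme" +
  assumes semi_terminal:
      "terminal_point V U \<Longrightarrow> t \<in> Hom V X U \<Longrightarrow> g \<in> Hom C X U \<Longrightarrow> g \<lesssim>\<^bsub>C\<^esub> t"
    and semi_product:
      "binary_product V Y\<^sub>1 Y\<^sub>2 P q\<^sub>1 q\<^sub>2 \<Longrightarrow> is_semi_product V C Y\<^sub>1 Y\<^sub>2 P q\<^sub>1 q\<^sub>2"

locale strict_cartesian_effect_category = cartesian_effect_category V C
  for V :: "('o, 'f, 'm) cart_weak_cat_scheme" and C :: "('o, 'f, 'n) effect_cat_scheme" +
  assumes strict: "strict C"

text \<open>The pair \<open>\<langle>f\<^sub>1, v\<^sub>2\<rangle>\<close> with \<open>v\<^sub>2\<close> pure; when \<open>f\<^sub>1\<close> is pure as well, it is the pair in \<open>V\<close>.\<close>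

definition semi_pair ::
    "('o, 'f, 'm) cart_weak_cat_scheme \<Rightarrow> ('o, 'f, 'n) effect_cat_scheme \<Rightarrow> 'f \<Rightarrow> 'f \<Rightarrow> 'f" where
  "semi_pair V C f\<^sub>1 v\<^sub>2 =
    (if f\<^sub>1 \<in> Funs V then pair V f\<^sub>1 v\<^sub>2
     else SOME h.
       h \<in> Hom C (src C f\<^sub>1) (prodpt V (tgt C f\<^sub>1) (tgt C v\<^sub>2)) \<and>
       prj1 V (tgt C f\<^sub>1) (tgt C v\<^sub>2) \<odot>\<^bsub>C\<^esub> h \<cong>\<^bsub>C\<^esub> f\<^sub>1 \<and>
       prj2 V (tgt C f\<^sub>1) (tgt C v\<^sub>2) \<odot>\<^bsub>C\<^esub> h \<lesssim>\<^bsub>C\<^esub> v\<^sub>2)"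

definition semi_prodfun ::
    "('o, 'f, 'm) cart_weak_cat_scheme \<Rightarrow> ('o, 'f, 'n) effect_cat_scheme \<Rightarrow> 'f \<Rightarrow> 'f \<Rightarrow> 'f" where
  "semi_prodfun V C f\<^sub>1 v\<^sub>2 = semi_pair V C
    (f\<^sub>1 \<odot>\<^bsub>C\<^esub> prj1 V (src C f\<^sub>1) (src C v\<^sub>2))
    (v\<^sub>2 \<odot>\<^bsub>C\<^esub> prj2 V (src C f\<^sub>1) (src C v\<^sub>2))"

section \<open>Arrows\<close>

text \<open>The sets \<open>A X Y\<close> need not be disjoint, so the operations are indexed by points:
  \<open>arr X Y : V(X,Y) \<rightarrow> A(X,Y)\<close>, \<open>bind X Y Z : A(X,Y) \<rightarrow> A(Y,Z) \<rightarrow> A(X,Z)\<close> is \<open>>>>\<close>, and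
  \<open>first X Y Z : A(X,Y) \<rightarrow> A(X \<times> Z, Y \<times> Z)\<close>.\<close>

locale arrow = cartesian_category V
  for V :: "('o, 'f, 'm) cart_weak_cat_scheme" (structure) +
  fixes A :: "'o \<Rightarrow> 'o \<Rightarrow> 'a set"
    and arr :: "'o \<Rightarrow> 'o \<Rightarrow> 'f \<Rightarrow> 'a"
    and bind :: "'o \<Rightarrow> 'o \<Rightarrow> 'o \<Rightarrow> 'a \<Rightarrow> 'a \<Rightarrow> 'a"
    and first :: "'o \<Rightarrow> 'o \<Rightarrow> 'o \<Rightarrow> 'a \<Rightarrow> 'a"
  assumes arr_closed:
      "\<lbrakk>X \<in> Pts V; Y \<in> Pts V; v \<in> Hom V X Y\<rbrakk> \<Longrightarrow> arr X Y v \<in> A X Y"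
    and bind_closed:
      "\<lbrakk>X \<in> Pts V; Y \<in> Pts V; Z \<in> Pts V; f \<in> A X Y; g \<in> A Y Z\<rbrakk> \<Longrightarrow> bind X Y Z f g \<in> A X Z"
    and first_closed:
      "\<lbrakk>X \<in> Pts V; Y \<in> Pts V; Z \<in> Pts V; f \<in> A X Y\<rbrakk> \<Longrightarrow>
        first X Y Z f \<in> A (prodpt V X Z) (prodpt V Y Z)"
    and arr_ident_bind:
      "\<lbrakk>X \<in> Pts V; Y \<in> Pts V; f \<in> A X Y\<rbrakk> \<Longrightarrow> bind X X Y (arr X X (ident V X)) f = f"
    and bind_arr_ident:
      "\<lbrakk>X \<in> Pts V; Y \<in> Pts V; f \<in> A X Y\<rbrakk> \<Longrightarrow> bind X Y Y f (arr Y Y (ident V Y)) = f"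
    and bind_assoc:
      "\<lbrakk>X \<in> Pts V; Y \<in> Pts V; Z \<in> Pts V; W \<in> Pts V; f \<in> A X Y; g \<in> A Y Z; h \<in> A Z W\<rbrakk> \<Longrightarrow>
        bind X Z W (bind X Y Z f g) h = bind X Y W f (bind Y Z W g h)"
    and arr_cmp:
      "\<lbrakk>X \<in> Pts V; Y \<in> Pts V; Z \<in> Pts V; v \<in> Hom V X Y; w \<in> Hom V Y Z\<rbrakk> \<Longrightarrow>
        arr X Z (w \<odot> v) = bind X Y Z (arr X Y v) (arr Y Z w)"
    and first_arr:
      "\<lbrakk>X \<in> Pts V; Y \<in> Pts V; Z \<in> Pts V; v \<in> Hom V X Y\<rbrakk> \<Longrightarrow>
        first X Y Z (arr X Y v) = arr (prodpt V X Z) (prodpt V Y Z) (prodfun V v (ident V Z))"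
    and first_bind:
      "\<lbrakk>X \<in> Pts V; Y \<in> Pts V; Z \<in> Pts V; W \<in> Pts V; f \<in> A X Y; g \<in> A Y Z\<rbrakk> \<Longrightarrow>
        first X Z W (bind X Y Z f g) =
          bind (prodpt V X W) (prodpt V Y W) (prodpt V Z W) (first X Y W f) (first Y Z W g)"
    and first_bind_arr_prodfun:
      "\<lbrakk>X \<in> Pts V; Y \<in> Pts V; Z \<in> Pts V; W \<in> Pts V; f \<in> A X Y; v \<in> Hom V Z W\<rbrakk> \<Longrightarrow>
        bind (prodpt V X Z) (prodpt V Y Z) (prodpt V Y W)
          (first X Y Z f) (arr (prodpt V Y Z) (prodpt V Y W) (prodfun V (ident V Y) v)) =
        bind (prodpt V X Z) (prodpt V X W) (prodpt V Y W)
          (arr (prodpt V X Z) (prodpt V X W) (prodfun V (ident V X) v)) (first X Y W f)"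
    and first_bind_arr_fst:
      "\<lbrakk>X \<in> Pts V; Y \<in> Pts V; Z \<in> Pts V; f \<in> A X Y\<rbrakk> \<Longrightarrow>
        bind (prodpt V X Z) (prodpt V Y Z) Y (first X Y Z f) (arr (prodpt V Y Z) Y (prj1 V Y Z)) =
        bind (prodpt V X Z) X Y (arr (prodpt V X Z) X (prj1 V X Z)) f"
    and first_first_bind_arr_assoc:
      "\<lbrakk>X \<in> Pts V; Y \<in> Pts V; Z \<in> Pts V; W \<in> Pts V; f \<in> A X Y\<rbrakk> \<Longrightarrow>
        bind (prodpt V (prodpt V X Z) W) (prodpt V (prodpt V Y Z) W) (prodpt V Y (prodpt V Z W))
          (first (prodpt V X Z) (prodpt V Y Z) W (first X Y Z f))
          (arr (prodpt V (prodpt V Y Z) W) (prodpt V Y (prodpt V Z W)) (assoc V Y Z W)) =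
        bind (prodpt V (prodpt V X Z) W) (prodpt V X (prodpt V Z W)) (prodpt V Y (prodpt V Z W))
          (arr (prodpt V (prodpt V X Z) W) (prodpt V X (prodpt V Z W)) (assoc V X Z W))
          (first X Y (prodpt V Z W) f)"

end

theory Submission
  imports Defs
begin

text \<open>
  In a strict cartesian effect category a function \<open>h : X \<rightarrow> Y\<^sub>1 \<times> Y\<^sub>2\<close> is determined by
  \<open>q\<^sub>1 \<circ> h\<close> together with any one pure \<open>v\<close> such that \<open>q\<^sub>2 \<circ> h \<lesssim> v\<close> (\<open>semi_product_eqI\<close>). In
  particular \<open>first f = f \<times> id\<close> is the only function with \<open>q\<^sub>1 \<circ> first f = f \<circ> p\<^sub>1\<close> and
  \<open>q\<^sub>2 \<circ> first f \<lesssim> p\<^sub>2\<close>. The category laws of an Arrow are those of \<open>C\<close>, the law for \<open>fst\<close> is the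
  first of these two properties, and the laws for composition and for \<open>id \<times> v\<close> follow by
  projecting both sides: the first projections are equal, and the second ones lie below the same
  pure function because \<open>\<lesssim>\<close> is stable under precomposition with any function and under
  postcomposition with pure ones.

  Associativity needs a detour. Projecting
  \<open>assoc \<circ> first (first f)\<close> to its second component \<open>Z \<times> W\<close> gives a function whose two components
  are known only up to \<open>\<lesssim>\<close>, and the axioms do not directly compare such a function with a pure pair.
  The inverse \<open>unassoc\<close> of \<open>assoc\<close> avoids this: the equation is equivalent to
  \<open>first (first f) = unassoc \<circ> first f \<circ> assoc\<close>, whose codomain is \<open>(Y \<times> Z) \<times> W\<close>. There
  the second component is \<open>W\<close>, which causes no trouble, and the first component is
  \<open>(id \<times> fst) \<circ> first f \<circ> assoc\<close>, where \<open>id \<times> fst\<close> can be moved across \<open>first f\<close>.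
\<close>

section \<open>Strict weak categories\<close>

locale category = weak_category C
  for C :: "('o, 'f, 'm) weak_cat_scheme" (structure) +
  assumes strict_cong: "strict C"
begin

lemma cong_iff_eq: "f \<in> Funs C \<Longrightarrow> f \<cong> g \<longleftrightarrow> f = g"
  using strict_cong cong_parallel unfolding strict_def parallel_def by metis

lemma hom_funs: "f \<in> Hom C X Y \<Longrightarrow> f \<in> Funs C"
  by (simp add: Hom_def)

lemma hom_src: "f \<in> Hom C X Y \<Longrightarrow> src C f = X"
  and hom_tgt: "f \<in> Hom C X Y \<Longrightarrow> tgt C f = Y"
  by (simp_all add: Hom_def)

lemma hom_dom: "f \<in> Hom C X Y \<Longrightarrow> X \<in> Pts C"
  and hom_cod: "f \<in> Hom C X Y \<Longrightarrow> Y \<in> Pts C"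
  using src_closed tgt_closed unfolding Hom_def by auto

lemma cmp_ident:
  assumes f: "f \<in> Hom C X Y"
  shows "f \<odot> ident C X = f"
  using ident_right[OF f] cong_iff_eq hom_funs[OF cmp_closed[OF ident_closed[OF hom_dom[OF f]] f]]
  by simp

lemma ident_cmp:
  assumes f: "f \<in> Hom C X Y"
  shows "ident C Y \<odot> f = f"
  using ident_left[OF f] cong_iff_eq hom_funs[OF cmp_closed[OF f ident_closed[OF hom_cod[OF f]]]]
  by simp

lemma cmp_assoc_eq:
  assumes f: "f \<in> Hom C X Y" and g: "g \<in> Hom C Y Z" and h: "h \<in> Hom C Z W"
  shows "(h \<odot> g) \<odot> f = h \<odot> (g \<odot> f)"
  using cmp_assoc[OF f g h] cong_iff_eq hom_funs[OF cmp_closed[OF cmp_closed[OF f g] h]]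
  by simp

end

section \<open>Products in a cartesian category\<close>

sublocale cartesian_category \<subseteq> category V
  by unfold_locales (rule strict)

context cartesian_category
begin

lemma prj1_hom: "X \<in> Pts V \<Longrightarrow> Y \<in> Pts V \<Longrightarrow> prj1 V X Y \<in> Hom V (prodpt V X Y) X"
  and prj2_hom: "X \<in> Pts V \<Longrightarrow> Y \<in> Pts V \<Longrightarrow> prj2 V X Y \<in> Hom V (prodpt V X Y) Y"
  using product unfolding binary_product_def by auto

lemma prodpt_closed: "X \<in> Pts V \<Longrightarrow> Y \<in> Pts V \<Longrightarrow> prodpt V X Y \<in> Pts V"
  using prj1_hom hom_dom by blast

lemma product_eqI:
  assumes h: "h \<in> Hom V X (prodpt V Y\<^sub>1 Y\<^sub>2)" and h': "h' \<in> Hom V X (prodpt V Y\<^sub>1 Y\<^sub>2)"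
    and Y: "Y\<^sub>1 \<in> Pts V" "Y\<^sub>2 \<in> Pts V"
    and 1: "prj1 V Y\<^sub>1 Y\<^sub>2 \<odot> h = prj1 V Y\<^sub>1 Y\<^sub>2 \<odot> h'"
    and 2: "prj2 V Y\<^sub>1 Y\<^sub>2 \<odot> h = prj2 V Y\<^sub>1 Y\<^sub>2 \<odot> h'"
  shows "h = h'"
proof -
  have f: "prj1 V Y\<^sub>1 Y\<^sub>2 \<odot> h' \<in> Hom V X Y\<^sub>1" "prj2 V Y\<^sub>1 Y\<^sub>2 \<odot> h' \<in> Hom V X Y\<^sub>2"
    using cmp_closed[OF h'] prj1_hom[OF Y] prj2_hom[OF Y] by auto
  then obtain k where "\<forall>h\<in>Hom V X (prodpt V Y\<^sub>1 Y\<^sub>2).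
      prj1 V Y\<^sub>1 Y\<^sub>2 \<odot> h \<cong> prj1 V Y\<^sub>1 Y\<^sub>2 \<odot> h' \<and> prj2 V Y\<^sub>1 Y\<^sub>2 \<odot> h \<cong> prj2 V Y\<^sub>1 Y\<^sub>2 \<odot> h' \<longrightarrow> h \<cong> k"
    using product[OF Y] hom_dom[OF h] unfolding binary_product_def ex1_cong_def by meson
  then have "h \<cong> k" "h' \<cong> k"
    using h h' 1 2 f cong_refl hom_funs by metis+
  then show ?thesis
    using h h' cong_iff_eq hom_funs by metis
qed

lemma
  assumes f: "f\<^sub>1 \<in> Hom V X Y\<^sub>1" "f\<^sub>2 \<in> Hom V X Y\<^sub>2"
  shows pair_hom: "pair V f\<^sub>1 f\<^sub>2 \<in> Hom V X (prodpt V Y\<^sub>1 Y\<^sub>2)"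
    and prj1_pair: "prj1 V Y\<^sub>1 Y\<^sub>2 \<odot> pair V f\<^sub>1 f\<^sub>2 = f\<^sub>1"
    and prj2_pair: "prj2 V Y\<^sub>1 Y\<^sub>2 \<odot> pair V f\<^sub>1 f\<^sub>2 = f\<^sub>2"
proof -
  have Y: "Y\<^sub>1 \<in> Pts V" "Y\<^sub>2 \<in> Pts V"
    using f hom_cod by auto
  have "\<exists>h. h \<in> Hom V X (prodpt V Y\<^sub>1 Y\<^sub>2) \<and> prj1 V Y\<^sub>1 Y\<^sub>2 \<odot> h \<cong> f\<^sub>1 \<and> prj2 V Y\<^sub>1 Y\<^sub>2 \<odot> h \<cong> f\<^sub>2"
    using product[OF Y] f hom_dom[OF f(1)] unfolding binary_product_def ex1_cong_def by meson
  from someI_ex[OF this]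
  have *: "pair V f\<^sub>1 f\<^sub>2 \<in> Hom V X (prodpt V Y\<^sub>1 Y\<^sub>2)"
      "prj1 V Y\<^sub>1 Y\<^sub>2 \<odot> pair V f\<^sub>1 f\<^sub>2 \<cong> f\<^sub>1" "prj2 V Y\<^sub>1 Y\<^sub>2 \<odot> pair V f\<^sub>1 f\<^sub>2 \<cong> f\<^sub>2"
    unfolding pair_def hom_src[OF f(1)] hom_tgt[OF f(1)] hom_tgt[OF f(2)] by auto
  then show "pair V f\<^sub>1 f\<^sub>2 \<in> Hom V X (prodpt V Y\<^sub>1 Y\<^sub>2)"
      "prj1 V Y\<^sub>1 Y\<^sub>2 \<odot> pair V f\<^sub>1 f\<^sub>2 = f\<^sub>1" "prj2 V Y\<^sub>1 Y\<^sub>2 \<odot> pair V f\<^sub>1 f\<^sub>2 = f\<^sub>2"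
    using cong_sym cong_iff_eq f hom_funs by metis+
qed

lemma
  assumes f: "f\<^sub>1 \<in> Hom V X\<^sub>1 Y\<^sub>1" "f\<^sub>2 \<in> Hom V X\<^sub>2 Y\<^sub>2"
  shows prodfun_hom: "prodfun V f\<^sub>1 f\<^sub>2 \<in> Hom V (prodpt V X\<^sub>1 X\<^sub>2) (prodpt V Y\<^sub>1 Y\<^sub>2)"
    and prj1_prodfun: "prj1 V Y\<^sub>1 Y\<^sub>2 \<odot> prodfun V f\<^sub>1 f\<^sub>2 = f\<^sub>1 \<odot> prj1 V X\<^sub>1 X\<^sub>2"
    and prj2_prodfun: "prj2 V Y\<^sub>1 Y\<^sub>2 \<odot> prodfun V f\<^sub>1 f\<^sub>2 = f\<^sub>2 \<odot> prj2 V X\<^sub>1 X\<^sub>2"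
proof -
  have X: "X\<^sub>1 \<in> Pts V" "X\<^sub>2 \<in> Pts V"
    using f hom_dom by auto
  note c = cmp_closed[OF prj1_hom[OF X] f(1)] cmp_closed[OF prj2_hom[OF X] f(2)]
  show "prodfun V f\<^sub>1 f\<^sub>2 \<in> Hom V (prodpt V X\<^sub>1 X\<^sub>2) (prodpt V Y\<^sub>1 Y\<^sub>2)"
      "prj1 V Y\<^sub>1 Y\<^sub>2 \<odot> prodfun V f\<^sub>1 f\<^sub>2 = f\<^sub>1 \<odot> prj1 V X\<^sub>1 X\<^sub>2"
      "prj2 V Y\<^sub>1 Y\<^sub>2 \<odot> prodfun V f\<^sub>1 f\<^sub>2 = f\<^sub>2 \<odot> prj2 V X\<^sub>1 X\<^sub>2"
    unfolding prodfun_def hom_src[OF f(1)] hom_src[OF f(2)]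
    using pair_hom[OF c] prj1_pair[OF c] prj2_pair[OF c] by auto
qed

lemma
  assumes P: "X \<in> Pts V" "Y \<in> Pts V" "Z \<in> Pts V"
  shows assoc_hom:
      "assoc V X Y Z \<in> Hom V (prodpt V (prodpt V X Y) Z) (prodpt V X (prodpt V Y Z))"
    and prj1_assoc:
      "prj1 V X (prodpt V Y Z) \<odot> assoc V X Y Z = prj1 V X Y \<odot> prj1 V (prodpt V X Y) Z"
    and prj1_prj2_assoc:
      "prj1 V Y Z \<odot> (prj2 V X (prodpt V Y Z) \<odot> assoc V X Y Z) =
        prj2 V X Y \<odot> prj1 V (prodpt V X Y) Z"
    and prj2_prj2_assoc:
      "prj2 V Y Z \<odot> (prj2 V X (prodpt V Y Z) \<odot> assoc V X Y Z) = prj2 V (prodpt V X Y) Z"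
proof -
  have XY: "prodpt V X Y \<in> Pts V"
    using P prodpt_closed by auto
  note p1 = prj1_hom[OF XY P(3)] and p2 = prj2_hom[OF XY P(3)]
  note a = cmp_closed[OF p1 prj1_hom[OF P(1,2)]] and b = cmp_closed[OF p1 prj2_hom[OF P(1,2)]]
  note c = pair_hom[OF b p2]
  show "assoc V X Y Z \<in> Hom V (prodpt V (prodpt V X Y) Z) (prodpt V X (prodpt V Y Z))"
      "prj1 V X (prodpt V Y Z) \<odot> assoc V X Y Z = prj1 V X Y \<odot> prj1 V (prodpt V X Y) Z"
      "prj1 V Y Z \<odot> (prj2 V X (prodpt V Y Z) \<odot> assoc V X Y Z) =
        prj2 V X Y \<odot> prj1 V (prodpt V X Y) Z"
      "prj2 V Y Z \<odot> (prj2 V X (prodpt V Y Z) \<odot> assoc V X Y Z) = prj2 V (prodpt V X Y) Z"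
    unfolding assoc_def
    using pair_hom[OF a c] prj1_pair[OF a c] prj2_pair[OF a c] prj1_pair[OF b p2] prj2_pair[OF b p2]
    by auto
qed

text \<open>The inverse of \<open>assoc\<close>. Its first component is written as \<open>id \<times> fst\<close> because products of this
  form commute with \<open>first f\<close>.\<close>

definition unassoc :: "'o \<Rightarrow> 'o \<Rightarrow> 'o \<Rightarrow> 'f" where
  "unassoc X Y Z = pair V
    (prodfun V (ident V X) (prj1 V Y Z))
    (prj2 V Y Z \<odot> prj2 V X (prodpt V Y Z))"

lemma
  assumes P: "X \<in> Pts V" "Y \<in> Pts V" "Z \<in> Pts V"
  shows unassoc_hom:
      "unassoc X Y Z \<in> Hom V (prodpt V X (prodpt V Y Z)) (prodpt V (prodpt V X Y) Z)"
    and prj1_unassoc: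
      "prj1 V (prodpt V X Y) Z \<odot> unassoc X Y Z = prodfun V (ident V X) (prj1 V Y Z)"
    and prj2_unassoc:
      "prj2 V (prodpt V X Y) Z \<odot> unassoc X Y Z = prj2 V Y Z \<odot> prj2 V X (prodpt V Y Z)"
proof -
  have YZ: "prodpt V Y Z \<in> Pts V"
    using P prodpt_closed by auto
  note a = prodfun_hom[OF ident_closed[OF P(1)] prj1_hom[OF P(2,3)]]
  note b = cmp_closed[OF prj2_hom[OF P(1) YZ] prj2_hom[OF P(2,3)]]
  show "unassoc X Y Z \<in> Hom V (prodpt V X (prodpt V Y Z)) (prodpt V (prodpt V X Y) Z)"
      "prj1 V (prodpt V X Y) Z \<odot> unassoc X Y Z = prodfun V (ident V X) (prj1 V Y Z)"
      "prj2 V (prodpt V X Y) Z \<odot> unassoc X Y Z = prj2 V Y Z \<odot> prj2 V X (prodpt V Y Z)"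
    unfolding unassoc_def using pair_hom[OF a b] prj1_pair[OF a b] prj2_pair[OF a b] by auto
qed

lemma prodfun_ident_prj1_assoc:
  assumes P: "X \<in> Pts V" "Y \<in> Pts V" "Z \<in> Pts V"
  shows "prodfun V (ident V X) (prj1 V Y Z) \<odot> assoc V X Y Z = prj1 V (prodpt V X Y) Z"
proof -
  have Q: "prodpt V X Y \<in> Pts V" "prodpt V Y Z \<in> Pts V"
    using P prodpt_closed by auto
  note as = assoc_hom[OF P] and id = ident_closed[OF P(1)]
  note p = prj1_hom[OF P(2,3)] and q = prj2_hom[OF P(1) Q(2)] and q1 = prj1_hom[OF P(1) Q(2)]
  note r = prj1_hom[OF P(1,2)] prj2_hom[OF P(1,2)]
  note pf = prodfun_hom[OF id p]
  show ?thesis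
  proof (rule product_eqI[OF cmp_closed[OF as pf] prj1_hom[OF Q(1) P(3)] P(1,2)])
    show "prj1 V X Y \<odot> (prodfun V (ident V X) (prj1 V Y Z) \<odot> assoc V X Y Z) =
        prj1 V X Y \<odot> prj1 V (prodpt V X Y) Z"
      unfolding cmp_assoc_eq[OF as pf r(1), symmetric] prj1_prodfun[OF id p] ident_cmp[OF q1]
      by (rule prj1_assoc[OF P])
    show "prj2 V X Y \<odot> (prodfun V (ident V X) (prj1 V Y Z) \<odot> assoc V X Y Z) =
        prj2 V X Y \<odot> prj1 V (prodpt V X Y) Z"
      unfolding cmp_assoc_eq[OF as pf r(2), symmetric] prj2_prodfun[OF id p]
        cmp_assoc_eq[OF as q p]
      by (rule prj1_prj2_assoc[OF P])
  qed
qed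

lemma assoc_unassoc:
  assumes P: "X \<in> Pts V" "Y \<in> Pts V" "Z \<in> Pts V"
  shows "assoc V X Y Z \<odot> unassoc X Y Z = ident V (prodpt V X (prodpt V Y Z))"
proof -
  have Q: "prodpt V X Y \<in> Pts V" "prodpt V Y Z \<in> Pts V"
    using P prodpt_closed by auto
  have T: "prodpt V X (prodpt V Y Z) \<in> Pts V"
    using P Q prodpt_closed by auto
  note as = assoc_hom[OF P] and un = unassoc_hom[OF P] and id = ident_closed[OF P(1)]
  note p1 = prj1_hom[OF P(2,3)] and p2 = prj2_hom[OF P(2,3)]
  note q1 = prj1_hom[OF P(1) Q(2)] and q2 = prj2_hom[OF P(1) Q(2)]
  note r1 = prj1_hom[OF P(1,2)] and r2 = prj2_hom[OF P(1,2)]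
  note s1 = prj1_hom[OF Q(1) P(3)]
  note au = cmp_closed[OF un as] and q2a = cmp_closed[OF as q2]
  have q: "prj2 V X (prodpt V Y Z) \<odot> (assoc V X Y Z \<odot> unassoc X Y Z) = prj2 V X (prodpt V Y Z)"
  proof (rule product_eqI[OF cmp_closed[OF au q2] q2 P(2,3)])
    show "prj1 V Y Z \<odot> (prj2 V X (prodpt V Y Z) \<odot> (assoc V X Y Z \<odot> unassoc X Y Z)) =
        prj1 V Y Z \<odot> prj2 V X (prodpt V Y Z)"
      unfolding cmp_assoc_eq[OF un as q2, symmetric] cmp_assoc_eq[OF un q2a p1, symmetric]
        prj1_prj2_assoc[OF P] cmp_assoc_eq[OF un s1 r2] prj1_unassoc[OF P]
      by (rule prj2_prodfun[OF id p1])
    show "prj2 V Y Z \<odot> (prj2 V X (prodpt V Y Z) \<odot> (assoc V X Y Z \<odot> unassoc X Y Z)) =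
        prj2 V Y Z \<odot> prj2 V X (prodpt V Y Z)"
      unfolding cmp_assoc_eq[OF un as q2, symmetric] cmp_assoc_eq[OF un q2a p2, symmetric]
        prj2_prj2_assoc[OF P]
      by (rule prj2_unassoc[OF P])
  qed
  show ?thesis
  proof (rule product_eqI[OF au ident_closed[OF T] P(1) Q(2)])
    show "prj1 V X (prodpt V Y Z) \<odot> (assoc V X Y Z \<odot> unassoc X Y Z) =
        prj1 V X (prodpt V Y Z) \<odot> ident V (prodpt V X (prodpt V Y Z))"
      unfolding cmp_assoc_eq[OF un as q1, symmetric] prj1_assoc[OF P] cmp_assoc_eq[OF un s1 r1]
        prj1_unassoc[OF P] prj1_prodfun[OF id p1] ident_cmp[OF q1] cmp_ident[OF q1] ..
    show "prj2 V X (prodpt V Y Z) \<odot> (assoc V X Y Z \<odot> unassoc X Y Z) =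
        prj2 V X (prodpt V Y Z) \<odot> ident V (prodpt V X (prodpt V Y Z))"
      unfolding q cmp_ident[OF q2] ..
  qed
qed

end

section \<open>Semi-products in a strict cartesian effect category\<close>

locale strict_effect_extension =
  V: cartesian_category V + strict_cartesian_effect_category V C
  for V :: "('o, 'f, 'm) cart_weak_cat_scheme" and C :: "('o, 'f, 'n) effect_cat_scheme" (structure)

sublocale strict_effect_extension \<subseteq> C: category C
  by unfold_locales (rule strict)

context strict_effect_extension
begin

lemma pts_eq: "Pts V = Pts C"
  using wide unfolding wide_subcategory_def by auto

lemma pure_hom: "v \<in> Hom V X Y \<Longrightarrow> v \<in> Hom C X Y"
  using wide unfolding wide_subcategory_def Hom_def by auto

lemma pure_ident: "X \<in> Pts V \<Longrightarrow> ident V X = ident C X"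
  using wide unfolding wide_subcategory_def by auto

lemma pure_cmp: "v \<in> Hom V X Y \<Longrightarrow> w \<in> Hom V Y Z \<Longrightarrow> w \<odot>\<^bsub>V\<^esub> v = w \<odot> v"
  using wide unfolding wide_subcategory_def Hom_def by auto

lemma cmp_pure_ident: "f \<in> Hom C X Y \<Longrightarrow> f \<odot> ident V X = f"
  and pure_ident_cmp: "f \<in> Hom C X Y \<Longrightarrow> ident V Y \<odot> f = f"
  using C.cmp_ident C.ident_cmp C.hom_dom C.hom_cod pure_ident pts_eq by auto

lemma hom_pure: "f \<in> Hom C X Y \<Longrightarrow> f \<in> Funs V \<Longrightarrow> f \<in> Hom V X Y"
  using wide unfolding wide_subcategory_def Hom_def by auto

lemma lesssim_refl: "f \<in> Hom C X Y \<Longrightarrow> f \<lesssim> f"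
  using cong_lesssim C.cong_refl C.hom_funs by metis

text \<open>Only an upper bound \<open>v\<close> of the second components is given, and they may well differ from
  each other and from \<open>v\<close>. In this form uniqueness applies to composites such as
  \<open>first g \<circ> first f\<close>, whose second projection is known only up to \<open>\<lesssim>\<close>.\<close>

lemma semi_product_eqI:
  assumes h: "h \<in> Hom C X (prodpt V Y\<^sub>1 Y\<^sub>2)" and h': "h' \<in> Hom C X (prodpt V Y\<^sub>1 Y\<^sub>2)"
    and Y\<^sub>1: "Y\<^sub>1 \<in> Pts V" and v: "v \<in> Hom V X Y\<^sub>2"
    and 1: "prj1 V Y\<^sub>1 Y\<^sub>2 \<odot> h = prj1 V Y\<^sub>1 Y\<^sub>2 \<odot> h'"
    and 2: "prj2 V Y\<^sub>1 Y\<^sub>2 \<odot> h \<lesssim> v" "prj2 V Y\<^sub>1 Y\<^sub>2 \<odot> h' \<lesssim> v"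
  shows "h = h'"
proof -
  note Y\<^sub>2 = V.hom_cod[OF v]
  have f: "prj1 V Y\<^sub>1 Y\<^sub>2 \<odot> h' \<in> Hom C X Y\<^sub>1"
    using C.cmp_closed[OF h'] pure_hom[OF V.prj1_hom[OF Y\<^sub>1 Y\<^sub>2]] by auto
  then obtain k where "\<forall>h\<in>Hom C X (prodpt V Y\<^sub>1 Y\<^sub>2).
      prj1 V Y\<^sub>1 Y\<^sub>2 \<odot> h \<cong> prj1 V Y\<^sub>1 Y\<^sub>2 \<odot> h' \<and> prj2 V Y\<^sub>1 Y\<^sub>2 \<odot> h \<lesssim> v \<longrightarrow> h \<cong> k"
    using semi_product[OF V.product[OF Y\<^sub>1 Y\<^sub>2]] C.hom_dom[OF h] v
    unfolding is_semi_product_def ex1_cong_def by meson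
  then have "h \<cong> k" "h' \<cong> k"
    using h h' 1 2 f C.cong_refl C.hom_funs by metis+
  then show ?thesis
    using h h' C.cong_iff_eq C.hom_funs by metis
qed

text \<open>If \<open>f\<close> happens to be pure then \<open>semi_pair\<close> is the pair in \<open>V\<close>, whose second projection equals
  \<open>v\<close>; otherwise it is only below \<open>v\<close>. The weaker description covers both.\<close>

lemma
  assumes f: "f \<in> Hom C X Y\<^sub>1" and v: "v \<in> Hom V X Y\<^sub>2"
  shows semi_pair_hom: "semi_pair V C f v \<in> Hom C X (prodpt V Y\<^sub>1 Y\<^sub>2)"
    and prj1_semi_pair: "prj1 V Y\<^sub>1 Y\<^sub>2 \<odot> semi_pair V C f v = f"
    and prj2_semi_pair: "prj2 V Y\<^sub>1 Y\<^sub>2 \<odot> semi_pair V C f v \<lesssim> v"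
proof -
  have Y: "Y\<^sub>1 \<in> Pts V" "Y\<^sub>2 \<in> Pts V"
    using f v C.hom_cod V.hom_cod pts_eq by auto
  have "semi_pair V C f v \<in> Hom C X (prodpt V Y\<^sub>1 Y\<^sub>2) \<and>
      prj1 V Y\<^sub>1 Y\<^sub>2 \<odot> semi_pair V C f v = f \<and> prj2 V Y\<^sub>1 Y\<^sub>2 \<odot> semi_pair V C f v \<lesssim> v"
  proof (cases "f \<in> Funs V")
    case True
    note fV = hom_pure[OF f True]
    note p = V.pair_hom[OF fV v]
    have "prj1 V Y\<^sub>1 Y\<^sub>2 \<odot> pair V f v = f" "prj2 V Y\<^sub>1 Y\<^sub>2 \<odot> pair V f v = v"
      using V.prj1_pair[OF fV v] V.prj2_pair[OF fV v]
        pure_cmp[OF p V.prj1_hom[OF Y]] pure_cmp[OF p V.prj2_hom[OF Y]] by auto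
    then show ?thesis
      using True pure_hom[OF p] lesssim_refl[OF pure_hom[OF v]] by (simp add: semi_pair_def)
  next
    case False
    have ex: "\<exists>h. h \<in> Hom C X (prodpt V Y\<^sub>1 Y\<^sub>2) \<and> prj1 V Y\<^sub>1 Y\<^sub>2 \<odot> h \<cong> f \<and> prj2 V Y\<^sub>1 Y\<^sub>2 \<odot> h \<lesssim> v"
      using semi_product[OF V.product[OF Y]] C.hom_dom[OF f] f v
      unfolding is_semi_product_def ex1_cong_def by meson
    have eq: "h \<cong> f \<longleftrightarrow> h = f" for h
      using C.cong_sym C.cong_iff_eq[OF C.hom_funs[OF f]] C.cong_refl[OF C.hom_funs[OF f]] by metis
    from someI_ex[OF ex] show ?thesis
      unfolding semi_pair_def C.hom_src[OF f] C.hom_tgt[OF f] C.hom_tgt[OF pure_hom[OF v]]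
      using False by (simp add: eq)
  qed
  then show "semi_pair V C f v \<in> Hom C X (prodpt V Y\<^sub>1 Y\<^sub>2)"
      "prj1 V Y\<^sub>1 Y\<^sub>2 \<odot> semi_pair V C f v = f" "prj2 V Y\<^sub>1 Y\<^sub>2 \<odot> semi_pair V C f v \<lesssim> v"
    by auto
qed

abbreviation first :: "'o \<Rightarrow> 'f \<Rightarrow> 'f" where
  "first Z f \<equiv> semi_prodfun V C f (ident V Z)"

lemma
  assumes f: "f \<in> Hom C X Y" and Z: "Z \<in> Pts V"
  shows first_hom: "first Z f \<in> Hom C (prodpt V X Z) (prodpt V Y Z)"
    and prj1_first: "prj1 V Y Z \<odot> first Z f = f \<odot> prj1 V X Z"
    and prj2_first: "prj2 V Y Z \<odot> first Z f \<lesssim> prj2 V X Z"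
proof -
  have X: "X \<in> Pts V"
    using f C.hom_dom pts_eq by auto
  note p2 = V.prj2_hom[OF X Z]
  have id: "ident V Z \<odot> prj2 V X Z = prj2 V X Z" "src C (ident V Z) = Z"
    using pure_ident_cmp[OF pure_hom[OF p2]] C.hom_src[OF pure_hom[OF V.ident_closed[OF Z]]] by auto
  have eq: "first Z f = semi_pair V C (f \<odot> prj1 V X Z) (prj2 V X Z)"
    unfolding semi_prodfun_def id C.hom_src[OF f] ..
  note fp = C.cmp_closed[OF pure_hom[OF V.prj1_hom[OF X Z]] f]
  show "first Z f \<in> Hom C (prodpt V X Z) (prodpt V Y Z)"
      "prj1 V Y Z \<odot> first Z f = f \<odot> prj1 V X Z"
      "prj2 V Y Z \<odot> first Z f \<lesssim> prj2 V X Z"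
    unfolding eq
    using semi_pair_hom[OF fp p2] prj1_semi_pair[OF fp p2] prj2_semi_pair[OF fp p2] by auto
qed

section \<open>The Arrow laws\<close>

lemma first_pure:
  assumes v: "v \<in> Hom V X Y" and Z: "Z \<in> Pts V"
  shows "first Z v = prodfun V v (ident V Z)"
proof -
  note X = V.hom_dom[OF v] and Y = V.hom_cod[OF v] and id = V.ident_closed[OF Z]
  note p1 = V.prj1_hom[OF X Z] and p2 = V.prj2_hom[OF X Z]
  note pf = V.prodfun_hom[OF v id]
  have 1: "prj1 V Y Z \<odot> prodfun V v (ident V Z) = v \<odot> prj1 V X Z"
    using V.prj1_prodfun[OF v id] pure_cmp[OF pf V.prj1_hom[OF Y Z]] pure_cmp[OF p1 v] by simp
  have 2: "prj2 V Y Z \<odot> prodfun V v (ident V Z) = prj2 V X Z"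
    using V.prj2_prodfun[OF v id] pure_cmp[OF pf V.prj2_hom[OF Y Z]] V.ident_cmp[OF p2] by simp
  show ?thesis
    by (rule semi_product_eqI[OF first_hom[OF pure_hom[OF v] Z] pure_hom[OF pf] Y p2])
      (simp_all add: 1 2 prj1_first[OF pure_hom[OF v] Z] prj2_first[OF pure_hom[OF v] Z]
        lesssim_refl[OF pure_hom[OF p2]])
qed

text \<open>The second projection of \<open>first g \<circ> first f\<close> is bounded in two steps,
  \<open>p\<^sub>2 \<circ> first g \<circ> first f \<lesssim> p\<^sub>2 \<circ> first f \<lesssim> p\<^sub>2\<close>.\<close>

lemma first_cmp:
  assumes f: "f \<in> Hom C X Y" and g: "g \<in> Hom C Y Z" and W: "W \<in> Pts V"
  shows "first W (g \<odot> f) = first W g \<odot> first W f"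
proof -
  have P: "X \<in> Pts V" "Y \<in> Pts V" "Z \<in> Pts V"
    using f g C.hom_dom C.hom_cod pts_eq by auto
  note gf = C.cmp_closed[OF f g] and F = first_hom[OF f W] and G = first_hom[OF g W]
  note px = pure_hom[OF V.prj1_hom[OF P(1) W]]
  note py = pure_hom[OF V.prj1_hom[OF P(2) W]]
  note pz = pure_hom[OF V.prj1_hom[OF P(3) W]] pure_hom[OF V.prj2_hom[OF P(3) W]]
  have 1: "prj1 V Z W \<odot> (first W g \<odot> first W f) = (g \<odot> f) \<odot> prj1 V X W"
    unfolding C.cmp_assoc_eq[OF F G pz(1), symmetric] prj1_first[OF g W] C.cmp_assoc_eq[OF F py g]
      prj1_first[OF f W] C.cmp_assoc_eq[OF px f g] ..
  have "(prj2 V Z W \<odot> first W g) \<odot> first W f \<lesssim> prj2 V Y W \<odot> first W f"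
    by (rule lesssim_precomp[OF F C.cmp_closed[OF G pz(2)] prj2_first[OF g W]])
  then have 2: "prj2 V Z W \<odot> (first W g \<odot> first W f) \<lesssim> prj2 V X W"
    unfolding C.cmp_assoc_eq[OF F G pz(2)] using prj2_first[OF f W] by (rule lesssim_trans)
  show ?thesis
    by (rule semi_product_eqI[OF first_hom[OF gf W] C.cmp_closed[OF F G] P(3)
          V.prj2_hom[OF P(1) W] _ prj2_first[OF gf W] 2])
      (simp only: 1 prj1_first[OF gf W])
qed

text \<open>Both sides are the semi-product \<open>f \<times> v\<close>: they project to \<open>f \<circ> p\<^sub>1\<close>, and below \<open>v \<circ> p\<^sub>2\<close>. On the
  left the bound uses that \<open>v\<close>, being pure, preserves \<open>\<lesssim>\<close>.\<close>

lemma prodfun_ident_first: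
  assumes f: "f \<in> Hom C X Y" and v: "v \<in> Hom V Z W"
  shows "prodfun V (ident V Y) v \<odot> first Z f = first W f \<odot> prodfun V (ident V X) v"
proof -
  have P: "X \<in> Pts V" "Y \<in> Pts V" "Z \<in> Pts V" "W \<in> Pts V"
    using f v C.hom_dom C.hom_cod V.hom_dom V.hom_cod pts_eq by auto
  note FZ = first_hom[OF f P(3)] and FW = first_hom[OF f P(4)]
  note iX = V.ident_closed[OF P(1)] and iY = V.ident_closed[OF P(2)]
  note vX = V.prodfun_hom[OF iX v] and vY = V.prodfun_hom[OF iY v]
  note cX = pure_hom[OF vX] and cY = pure_hom[OF vY] and cv = pure_hom[OF v]
  note xz1 = V.prj1_hom[OF P(1,3)] and xz2 = V.prj2_hom[OF P(1,3)]
  note xw1 = V.prj1_hom[OF P(1,4)] and xw2 = V.prj2_hom[OF P(1,4)]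
  note yz1 = V.prj1_hom[OF P(2,3)] and yz2 = V.prj2_hom[OF P(2,3)]
  note yw1 = V.prj1_hom[OF P(2,4)] and yw2 = V.prj2_hom[OF P(2,4)]
  have X1: "prj1 V X W \<odot> prodfun V (ident V X) v = prj1 V X Z"
    using V.prj1_prodfun[OF iX v] pure_cmp[OF vX xw1] V.ident_cmp[OF xz1] by simp
  have X2: "prj2 V X W \<odot> prodfun V (ident V X) v = v \<odot> prj2 V X Z"
    using V.prj2_prodfun[OF iX v] pure_cmp[OF vX xw2] pure_cmp[OF xz2 v] by simp
  have Y1: "prj1 V Y W \<odot> prodfun V (ident V Y) v = prj1 V Y Z"
    using V.prj1_prodfun[OF iY v] pure_cmp[OF vY yw1] V.ident_cmp[OF yz1] by simp
  have Y2: "prj2 V Y W \<odot> prodfun V (ident V Y) v = v \<odot> prj2 V Y Z"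
    using V.prj2_prodfun[OF iY v] pure_cmp[OF vY yw2] pure_cmp[OF yz2 v] by simp
  have vp: "v \<odot> prj2 V X Z \<in> Hom V (prodpt V X Z) W"
    using V.cmp_closed[OF xz2 v] pure_cmp[OF xz2 v] by simp
  have L1: "prj1 V Y W \<odot> (prodfun V (ident V Y) v \<odot> first Z f) = f \<odot> prj1 V X Z"
    unfolding C.cmp_assoc_eq[OF FZ cY pure_hom[OF yw1], symmetric] Y1
    by (rule prj1_first[OF f P(3)])
  have R1: "prj1 V Y W \<odot> (first W f \<odot> prodfun V (ident V X) v) = f \<odot> prj1 V X Z"
    unfolding C.cmp_assoc_eq[OF cX FW pure_hom[OF yw1], symmetric] prj1_first[OF f P(4)]
      C.cmp_assoc_eq[OF cX pure_hom[OF xw1] f] X1 ..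
  have L2: "prj2 V Y W \<odot> (prodfun V (ident V Y) v \<odot> first Z f) \<lesssim> v \<odot> prj2 V X Z"
    unfolding C.cmp_assoc_eq[OF FZ cY pure_hom[OF yw2], symmetric] Y2
      C.cmp_assoc_eq[OF FZ pure_hom[OF yz2] cv]
    by (rule lesssim_postcomp[OF C.cmp_closed[OF FZ pure_hom[OF yz2]] v prj2_first[OF f P(3)]])
  have R2: "prj2 V Y W \<odot> (first W f \<odot> prodfun V (ident V X) v) \<lesssim> v \<odot> prj2 V X Z"
    unfolding C.cmp_assoc_eq[OF cX FW pure_hom[OF yw2], symmetric] X2[symmetric]
    by (rule lesssim_precomp[OF cX C.cmp_closed[OF FW pure_hom[OF yw2]] prj2_first[OF f P(4)]])
  show ?thesis
    by (rule semi_product_eqI[OF C.cmp_closed[OF FZ cY] C.cmp_closed[OF cX FW] P(2) vp _ L2 R2])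
      (simp only: L1 R1)
qed

text \<open>The conjugate of \<open>first f\<close> by the associativity isomorphism has the two properties that
  characterise \<open>first (first f)\<close>. For the first projection, \<open>prodfun_ident_first\<close> with \<open>v = fst\<close>
  moves \<open>id \<times> fst\<close> across \<open>first f\<close>.\<close>

lemma first_first_conv_unassoc:
  assumes f: "f \<in> Hom C X Y" and Z: "Z \<in> Pts V" and W: "W \<in> Pts V"
  shows "first W (first Z f) =
    V.unassoc Y Z W \<odot> (first (prodpt V Z W) f \<odot> assoc V X Z W)"
proof -
  have P: "X \<in> Pts V" "Y \<in> Pts V"
    using f C.hom_dom C.hom_cod pts_eq by auto
  have Q: "prodpt V Z W \<in> Pts V" "prodpt V X Z \<in> Pts V" "prodpt V Y Z \<in> Pts V"
    using P Z W V.prodpt_closed by auto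
  note F = first_hom[OF f Z] and G = first_hom[OF f Q(1)]
  note FF = first_hom[OF F W]
  note asV = V.assoc_hom[OF P(1) Z W] and unV = V.unassoc_hom[OF P(2) Z W]
  note as = pure_hom[OF asV] and un = pure_hom[OF unV]
  note Ga = C.cmp_closed[OF as G] and p1 = V.prj1_hom[OF Z W] and p2 = V.prj2_hom[OF Z W]
  note r1 = V.prj1_hom[OF Q(3) W] and r2 = V.prj2_hom[OF Q(3) W]
  note x2 = V.prj2_hom[OF P(1) Q(1)] and y2 = V.prj2_hom[OF P(2) Q(1)]
  note iX = V.ident_closed[OF P(1)] and iY = V.ident_closed[OF P(2)]
  note tX = V.prodfun_hom[OF iX p1] and tY = V.prodfun_hom[OF iY p1]
  note cX = pure_hom[OF tX] and cY = pure_hom[OF tY]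
  have U1: "prj1 V (prodpt V Y Z) W \<odot> V.unassoc Y Z W = prodfun V (ident V Y) (prj1 V Z W)"
    using V.prj1_unassoc[OF P(2) Z W] pure_cmp[OF unV r1] by simp
  have U2: "prj2 V (prodpt V Y Z) W \<odot> V.unassoc Y Z W = prj2 V Z W \<odot> prj2 V Y (prodpt V Z W)"
    using V.prj2_unassoc[OF P(2) Z W] pure_cmp[OF unV r2] pure_cmp[OF y2 p2] by simp
  have A1: "prodfun V (ident V X) (prj1 V Z W) \<odot> assoc V X Z W = prj1 V (prodpt V X Z) W"
    using V.prodfun_ident_prj1_assoc[OF P(1) Z W] pure_cmp[OF asV tX] by simp
  have A2: "prj2 V Z W \<odot> (prj2 V X (prodpt V Z W) \<odot> assoc V X Z W) = prj2 V (prodpt V X Z) W"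
    using V.prj2_prj2_assoc[OF P(1) Z W] pure_cmp[OF asV x2]
      pure_cmp[OF V.cmp_closed[OF asV x2] p2] by simp
  have 1: "prj1 V (prodpt V Y Z) W \<odot> (V.unassoc Y Z W \<odot> (first (prodpt V Z W) f \<odot> assoc V X Z W))
      = first Z f \<odot> prj1 V (prodpt V X Z) W"
    unfolding C.cmp_assoc_eq[OF Ga un pure_hom[OF r1], symmetric] U1
      C.cmp_assoc_eq[OF as G cY, symmetric] prodfun_ident_first[OF f p1]
      C.cmp_assoc_eq[OF as cX F] A1 ..
  have "prj2 V Y (prodpt V Z W) \<odot> (first (prodpt V Z W) f \<odot> assoc V X Z W)
      \<lesssim> prj2 V X (prodpt V Z W) \<odot> assoc V X Z W"
    unfolding C.cmp_assoc_eq[OF as G pure_hom[OF y2], symmetric]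
    by (rule lesssim_precomp[OF as C.cmp_closed[OF G pure_hom[OF y2]] prj2_first[OF f Q(1)]])
  from lesssim_postcomp[OF C.cmp_closed[OF Ga pure_hom[OF y2]] p2 this]
  have 2: "prj2 V (prodpt V Y Z) W \<odot> (V.unassoc Y Z W \<odot> (first (prodpt V Z W) f \<odot> assoc V X Z W))
      \<lesssim> prj2 V (prodpt V X Z) W"
    unfolding C.cmp_assoc_eq[OF Ga un pure_hom[OF r2], symmetric] U2
      C.cmp_assoc_eq[OF Ga pure_hom[OF y2] pure_hom[OF p2]] A2 .
  show ?thesis
    by (rule semi_product_eqI[OF FF C.cmp_closed[OF Ga un] Q(3) V.prj2_hom[OF Q(2) W] _
          prj2_first[OF F W] 2])
      (simp only: 1 prj1_first[OF F W])
qed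

lemma assoc_first_first:
  assumes f: "f \<in> Hom C X Y" and Z: "Z \<in> Pts V" and W: "W \<in> Pts V"
  shows "assoc V Y Z W \<odot> first W (first Z f) = first (prodpt V Z W) f \<odot> assoc V X Z W"
proof -
  have P: "X \<in> Pts V" "Y \<in> Pts V" "prodpt V Z W \<in> Pts V"
    using f C.hom_dom C.hom_cod pts_eq Z W V.prodpt_closed by auto
  note asY = V.assoc_hom[OF P(2) Z W] and un = V.unassoc_hom[OF P(2) Z W]
  note Ga = C.cmp_closed[OF pure_hom[OF V.assoc_hom[OF P(1) Z W]] first_hom[OF f P(3)]]
  have inv: "assoc V Y Z W \<odot> V.unassoc Y Z W = ident V (prodpt V Y (prodpt V Z W))"
    using V.assoc_unassoc[OF P(2) Z W] pure_cmp[OF un asY] by simp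
  show ?thesis
    unfolding first_first_conv_unassoc[OF f Z W]
      C.cmp_assoc_eq[OF Ga pure_hom[OF un] pure_hom[OF asY], symmetric] inv
    by (rule pure_ident_cmp[OF Ga])
qed

end

theorem theorem4p2:
  fixes V :: "('o, 'f) cart_weak_cat" and C :: "('o, 'f) effect_cat"
  assumes "cartesian_category V"
    and "strict_cartesian_effect_category V C"
  shows "arrow V
    (\<lambda>X Y. Hom C X Y)
    (\<lambda>X Y v. v)
    (\<lambda>X Y Z f g. g \<odot>\<^bsub>C\<^esub> f)
    (\<lambda>X Y Z f. semi_prodfun V C f (ident V Z))"
proof -
  interpret strict_effect_extension V C
    using assms by (rule strict_effect_extension.intro)
  show ?thesis
    by (intro arrow.intro arrow_axioms.intro assms(1))
      (simp_all add: pure_hom C.cmp_closed first_hom cmp_pure_ident pure_ident_cmp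
        C.cmp_assoc_eq pure_cmp first_pure first_cmp prodfun_ident_first prj1_first
        assoc_first_first)
qed

end
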